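(* Let $n\ge 2$ and let $*:(\mathcal{K}^n)^2\to\mathcal{K}^n$ be an operation. Then $*$ is continuous in the Hausdorff metric, $GL(n)$ covariant, and has the identity property if and only if it is Minkowski addition, i.e. $K*L=K+L$ for all $K,L\in\mathcal{K}^n$.
   Context: $\mathcal{K}^n$ is the class of nonempty compact convex subsets of $\mathbb{R}^n$; $o$ is the origin. Minkowski addition: $K+L=\{x+y:x\in K,\ y\in L\}$. Properties of $*$ (for all $K,L,\dots\in\mathcal{K}^n$): continuous: $K_m\to K$ and $L_m\to L$ in the Hausdorff metric imply $K_m*L_m\to K*L$ in the Hausdorff metric; $GL(n)$ covariant: $\phi(K*L)=(\phi K)*(\phi L)$ for all $\phi\in GL(n)$; identity property: $K*\{o\}=K=\{o\}*K$. *)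

theory Defs
  imports "HOL-Analysis.Analysis"
begin

definition convex_bodies :: "(real ^ 'n) set set" where
  "convex_bodies = {K. K \<noteq> {} \<and> compact K \<and> convex K}"

(* A real supremum, hence meaningful only for nonempty bounded sets;
   below it is applied to members of convex_bodies only. *)
definition hausdorff_dist :: "(real ^ 'n) set \<Rightarrow> (real ^ 'n) set \<Rightarrow> real" where
  "hausdorff_dist K L = max (SUP x\<in>K. infdist x L) (SUP y\<in>L. infdist y K)"

definition hausdorff_tendsto :: "(nat \<Rightarrow> (real ^ 'n) set) \<Rightarrow> (real ^ 'n) set \<Rightarrow> bool" where
  "hausdorff_tendsto Ks K \<longleftrightarrow> (\<lambda>m. hausdorff_dist (Ks m) K) \<longlonglongrightarrow> 0"

(* Operations are total functions on sets that map convex bodies to convex bodies;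
   all properties are relativised to convex_bodies, so values elsewhere are irrelevant. *)
definition body_operation ::
    "((real ^ 'n) set \<Rightarrow> (real ^ 'n) set \<Rightarrow> (real ^ 'n) set) \<Rightarrow> bool" where
  "body_operation f \<longleftrightarrow> (\<forall>K\<in>convex_bodies. \<forall>L\<in>convex_bodies. f K L \<in> convex_bodies)"

definition hausdorff_continuous ::
    "((real ^ 'n) set \<Rightarrow> (real ^ 'n) set \<Rightarrow> (real ^ 'n) set) \<Rightarrow> bool" where
  "hausdorff_continuous f \<longleftrightarrow>
     (\<forall>Ks Ls. \<forall>K\<in>convex_bodies. \<forall>L\<in>convex_bodies.
        (\<forall>m. Ks m \<in> convex_bodies) \<longrightarrow> (\<forall>m. Ls m \<in> convex_bodies) \<longrightarrow>
        hausdorff_tendsto Ks K \<longrightarrow> hausdorff_tendsto Ls L \<longrightarrow>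
        hausdorff_tendsto (\<lambda>m. f (Ks m) (Ls m)) (f K L))"

definition GL_covariant ::
    "((real ^ 'n) set \<Rightarrow> (real ^ 'n) set \<Rightarrow> (real ^ 'n) set) \<Rightarrow> bool" where
  "GL_covariant f \<longleftrightarrow>
     (\<forall>A :: real ^ 'n ^ 'n. invertible A \<longrightarrow>
        (\<forall>K\<in>convex_bodies. \<forall>L\<in>convex_bodies.
           (\<lambda>x. A *v x) ` f K L = f ((\<lambda>x. A *v x) ` K) ((\<lambda>x. A *v x) ` L)))"

definition identity_property ::
    "((real ^ 'n) set \<Rightarrow> (real ^ 'n) set \<Rightarrow> (real ^ 'n) set) \<Rightarrow> bool" where
  "identity_property f \<longleftrightarrow> (\<forall>K\<in>convex_bodies. f K {0} = K \<and> f {0} K = K)"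

end

theory Submission
  imports Defs
begin

text \<open>Approximating by invertible matrices, continuity extends the covariance to the rank-one maps
  \<open>x \<mapsto> (u \<bullet> x) e\<^sub>i\<close>, so the projection of \<open>K * L\<close> to a line depends only on the projections of
  \<open>K\<close> and \<open>L\<close>: \<open>u \<bullet> (K * L) = G (u \<bullet> K) (u \<bullet> L)\<close> with an operation \<open>G\<close> on intervals that does not
  depend on \<open>u\<close>. Writing a functional as a sum \<open>u + v\<close> and choosing planar bodies gives
  inclusions for \<open>G\<close>. The crossed segments \<open>[a,b] \<times> {0}\<close> and \<open>{0} \<times> [c,d]\<close> yield
  \<open>G [a,b] [c,d] \<subseteq> [a+c, b+d]\<close>. For the triangles \<open>p \<le> b, q \<le> 0, a \<le> p + q\<close> the functionals \<open>p\<close>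
  and \<open>p + q\<close> have the same range \<open>[a,b]\<close>, which forces the right end of
  \<open>G [a-b,0] [c-d,0]\<close> to be nonnegative; a translation then gives \<open>b + d \<in> G [a,b] [c,d]\<close>.
  So \<open>K * L\<close> and \<open>K + L\<close> have the same support function.\<close>

section \<open>Convex bodies under linear images and sums\<close>

lemma convex_bodiesD:
  assumes "K \<in> convex_bodies"
  shows "K \<noteq> {}" "compact K" "convex K"
  using assms by (auto simp: convex_bodies_def)

lemma convex_bodies_linear_image:
  fixes K :: "(real ^ 'n) set" and g :: "real ^ 'n \<Rightarrow> real ^ 'n"
  assumes "linear g" "K \<in> convex_bodies"
  shows "g ` K \<in> convex_bodies"
  using assms
  by (auto simp: convex_bodies_def convex_linear_image
      intro!: compact_continuous_image linear_continuous_on linear_conv_bounded_linear[THEN iffD1])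

lemma convex_bodies_plus:
  assumes "K \<in> convex_bodies" "L \<in> convex_bodies"
  shows "K + L \<in> convex_bodies"
proof -
  have "K + L = {x + y | x y. x \<in> K \<and> y \<in> L}"
    by (auto simp: set_plus_def)
  then have "compact (K + L)"
    using compact_sums[of K L] assms by (simp add: convex_bodies_def)
  moreover have "K + L \<noteq> {}"
    using assms by (auto simp: convex_bodies_def set_plus_def)
  ultimately show ?thesis
    using assms by (simp add: convex_bodies_def convex_set_plus)
qed

lemma convex_bodies_singleton: "{x} \<in> convex_bodies"
  by (simp add: convex_bodies_def)

subsection \<open>The Hausdorff distance\<close>

lemma bdd_above_infdist:
  fixes K L :: "'a :: metric_space set"
  assumes "compact K"
  shows "bdd_above ((\<lambda>x. infdist x L) ` K)"
  using assms
  by (intro bounded_imp_bdd_above compact_imp_bounded compact_continuous_image continuous_intros)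

text \<open>The infimum is attained because \<open>L\<close> is closed. Together with
  \<open>hausdorff_dist_le\<close> this replaces suprema by nearby points in all later
  estimates.\<close>

lemma exists_dist_le_hausdorff_dist:
  assumes "K \<in> convex_bodies" "L \<in> convex_bodies" "x \<in> K"
  obtains y where "y \<in> L" "dist x y \<le> hausdorff_dist K L"
proof -
  have "infdist x L \<le> (SUP x\<in>K. infdist x L)"
    by (rule cSUP_upper[OF assms(3) bdd_above_infdist[OF convex_bodiesD(2)[OF assms(1)]]])
  then have "infdist x L \<le> hausdorff_dist K L"
    by (simp add: hausdorff_dist_def)
  moreover obtain y where "y \<in> L" "infdist x L = dist x y"
    using infdist_attains_inf[of L x] assms(2) by (auto dest: convex_bodiesD compact_imp_closed)
  ultimately show ?thesis
    using that by auto
qed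

lemma hausdorff_dist_commute: "hausdorff_dist K L = hausdorff_dist L K"
  by (simp add: hausdorff_dist_def max.commute)

lemma hausdorff_dist_nonneg:
  assumes "K \<in> convex_bodies" "L \<in> convex_bodies"
  shows "0 \<le> hausdorff_dist K L"
proof -
  obtain x where "x \<in> K"
    using assms convex_bodiesD by blast
  with exists_dist_le_hausdorff_dist[OF assms] show ?thesis
    by (meson order_trans zero_le_dist)
qed

lemma hausdorff_dist_le:
  assumes "K \<noteq> {}" "L \<noteq> {}"
    and "\<And>x. x \<in> K \<Longrightarrow> \<exists>y\<in>L. dist x y \<le> e"
    and "\<And>y. y \<in> L \<Longrightarrow> \<exists>x\<in>K. dist x y \<le> e"
  shows "hausdorff_dist K L \<le> e"
proof -
  have "(SUP x\<in>K. infdist x L) \<le> e"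
    using assms by (intro cSUP_least) (auto intro: infdist_le2)
  moreover have "(SUP y\<in>L. infdist y K) \<le> e"
    using assms by (intro cSUP_least) (auto intro: infdist_le2 simp: dist_commute)
  ultimately show ?thesis
    by (simp add: hausdorff_dist_def)
qed

lemma hausdorff_tendstoI:
  assumes "\<And>m. Ks m \<in> convex_bodies" "K \<in> convex_bodies"
    and "\<And>m. hausdorff_dist (Ks m) K \<le> e m" "e \<longlonglongrightarrow> 0"
  shows "hausdorff_tendsto Ks K"
  unfolding hausdorff_tendsto_def
  by (rule tendsto_sandwich[OF _ _ tendsto_const assms(4)])
    (auto simp: assms hausdorff_dist_nonneg)

text \<open>A point of \<open>K\<close> is close to some point of \<open>Ks m\<close>, which is
  close to some point of \<open>K'\<close>; hence its distance to the closed set \<open>K'\<close>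
  vanishes. By symmetry limits are unique.\<close>

lemma hausdorff_tendsto_subset:
  assumes bodies: "\<And>m. Ks m \<in> convex_bodies" "K \<in> convex_bodies" "K' \<in> convex_bodies"
    and lim: "hausdorff_tendsto Ks K" "hausdorff_tendsto Ks K'"
  shows "K \<subseteq> K'"
proof
  fix x assume "x \<in> K"
  have "infdist x K' \<le> hausdorff_dist (Ks m) K + hausdorff_dist (Ks m) K'" for m
  proof -
    obtain y where "y \<in> Ks m" "dist x y \<le> hausdorff_dist (Ks m) K"
      using exists_dist_le_hausdorff_dist \<open>x \<in> K\<close> bodies by (metis hausdorff_dist_commute)
    moreover from this obtain z where "z \<in> K'" "dist y z \<le> hausdorff_dist (Ks m) K'"
      using exists_dist_le_hausdorff_dist bodies by metis
    ultimately show ?thesis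
      using dist_triangle[of x z y] by (intro infdist_le2[of z]) auto
  qed
  moreover have "(\<lambda>m. hausdorff_dist (Ks m) K + hausdorff_dist (Ks m) K') \<longlonglongrightarrow> 0"
    using tendsto_add[OF lim[unfolded hausdorff_tendsto_def]] by simp
  ultimately have "infdist x K' \<le> 0"
    by (intro LIMSEQ_le_const) auto
  then have "infdist x K' = 0"
    using infdist_nonneg[of x K'] by linarith
  then show "x \<in> K'"
    using in_closed_iff_infdist_zero bodies(3) by (metis convex_bodiesD(1,2) compact_imp_closed)
qed

lemma hausdorff_tendsto_unique:
  assumes "\<And>m. Ks m \<in> convex_bodies" "K \<in> convex_bodies" "K' \<in> convex_bodies"
    and "hausdorff_tendsto Ks K" "hausdorff_tendsto Ks K'"
  shows "K = K'"
  using hausdorff_tendsto_subset assms by blast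

text \<open>Approximating the two summands of a point separately suffices. This yields the joint
  continuity of Minkowski addition.\<close>

lemma hausdorff_dist_plus_le:
  assumes "K \<in> convex_bodies" "L \<in> convex_bodies" "K' \<in> convex_bodies" "L' \<in> convex_bodies"
  shows "hausdorff_dist (K + L) (K' + L') \<le> hausdorff_dist K K' + hausdorff_dist L L'"
proof -
  have *: "\<exists>y\<in>K' + L'. dist x y \<le> hausdorff_dist K K' + hausdorff_dist L L'"
    if bodies: "K \<in> convex_bodies" "L \<in> convex_bodies" "K' \<in> convex_bodies" "L' \<in> convex_bodies"
      and x: "x \<in> K + L" for K L K' L' :: "(real ^ 'a) set" and x
  proof -
    from x obtain k l where kl: "x = k + l" "k \<in> K" "l \<in> L"
      by (auto elim: set_plus_elim)
    obtain k' where k': "k' \<in> K'" "dist k k' \<le> hausdorff_dist K K'"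
      using exists_dist_le_hausdorff_dist bodies kl by metis
    obtain l' where l': "l' \<in> L'" "dist l l' \<le> hausdorff_dist L L'"
      using exists_dist_le_hausdorff_dist bodies kl by metis
    have "dist x (k' + l') \<le> dist k k' + dist l l'"
      unfolding kl by (rule dist_triangle_add)
    with k' l' show ?thesis
      by (intro bexI[of _ "k' + l'"]) auto
  qed
  show ?thesis
    using *[OF assms] *[OF assms(3,4,1,2)] assms
    by (intro hausdorff_dist_le convex_bodiesD(1) convex_bodies_plus)
      (auto simp: dist_commute hausdorff_dist_commute)
qed

text \<open>On the bounded set \<open>K\<close> the perturbation moves every point by at most
  \<open>\<bar>e m\<bar> * B\<close>. It serves to approximate a singular map \<open>g\<close> by
  invertible ones.\<close>

lemma hausdorff_tendsto_perturbed_image: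
  fixes g :: "real ^ 'n \<Rightarrow> real ^ 'n"
  assumes K: "K \<in> convex_bodies" and g: "linear g" and e: "e \<longlonglongrightarrow> 0"
  shows "hausdorff_tendsto (\<lambda>m. (\<lambda>x. g x + e m *\<^sub>R x) ` K) (g ` K)"
proof -
  obtain B where B: "\<And>x. x \<in> K \<Longrightarrow> norm x \<le> B"
    using K by (metis convex_bodiesD(2) compact_imp_bounded bounded_iff)
  have lin: "linear (\<lambda>x. g x + e m *\<^sub>R x)" for m
    using g by (intro linear_compose_add) auto
  have d: "dist (g x + e m *\<^sub>R x) (g x) \<le> \<bar>e m\<bar> * B" if "x \<in> K" for m x
    using B[OF that] by (simp add: dist_norm mult_left_mono)
  show ?thesis
  proof (rule hausdorff_tendstoI[where e = "\<lambda>m. \<bar>e m\<bar> * B"])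
    show "hausdorff_dist ((\<lambda>x. g x + e m *\<^sub>R x) ` K) (g ` K) \<le> \<bar>e m\<bar> * B" for m
      using K d by (intro hausdorff_dist_le) (auto dest: convex_bodiesD)
    show "(\<lambda>m. \<bar>e m\<bar> * B) \<longlonglongrightarrow> 0"
      using tendsto_mult_right[OF tendsto_rabs[OF e], of B] by simp
  qed (use K g lin convex_bodies_linear_image in auto)
qed

subsection \<open>Minkowski addition\<close>

text \<open>Outside \<open>convex_bodies\<close> the operation \<open>f\<close> is arbitrary, so
  here and in the next two lemmas the properties are shown for \<open>f\<close> itself and not for
  \<open>(+)\<close>.\<close>

lemma hausdorff_continuous_Minkowski:
  fixes f :: "(real ^ 'n) set \<Rightarrow> (real ^ 'n) set \<Rightarrow> (real ^ 'n) set"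
  assumes "\<And>K L. K \<in> convex_bodies \<Longrightarrow> L \<in> convex_bodies \<Longrightarrow> f K L = K + L"
  shows "hausdorff_continuous f"
  unfolding hausdorff_continuous_def
proof (intro allI ballI impI)
  fix Ks Ls and K L :: "(real ^ 'n) set"
  assume bodies: "K \<in> convex_bodies" "L \<in> convex_bodies"
      "\<forall>m. Ks m \<in> convex_bodies" "\<forall>m. Ls m \<in> convex_bodies"
    and "hausdorff_tendsto Ks K" "hausdorff_tendsto Ls L"
  then have "(\<lambda>m. hausdorff_dist (Ks m) K + hausdorff_dist (Ls m) L) \<longlonglongrightarrow> 0"
    unfolding hausdorff_tendsto_def using tendsto_add by fastforce
  then show "hausdorff_tendsto (\<lambda>m. f (Ks m) (Ls m)) (f K L)"
    using bodies assms
    by (intro hausdorff_tendstoI) (auto simp: convex_bodies_plus hausdorff_dist_plus_le)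
qed

lemma GL_covariant_Minkowski:
  fixes f :: "(real ^ 'n) set \<Rightarrow> (real ^ 'n) set \<Rightarrow> (real ^ 'n) set"
  assumes "\<And>K L. K \<in> convex_bodies \<Longrightarrow> L \<in> convex_bodies \<Longrightarrow> f K L = K + L"
  shows "GL_covariant f"
  using assms
  by (simp add: GL_covariant_def convex_bodies_linear_image matrix_vector_mul_linear set_plus_image
      image_image case_prod_unfold matrix_vector_right_distrib)
    (force simp: set_plus_def matrix_vector_right_distrib image_iff)

lemma identity_property_Minkowski:
  fixes f :: "(real ^ 'n) set \<Rightarrow> (real ^ 'n) set \<Rightarrow> (real ^ 'n) set"
  assumes "\<And>K L. K \<in> convex_bodies \<Longrightarrow> L \<in> convex_bodies \<Longrightarrow> f K L = K + L"
  shows "identity_property f"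
  using assms by (simp add: identity_property_def convex_bodies_singleton set_plus_def)

subsection \<open>Reduction to intervals\<close>

lemma rank_one_covariant:
  fixes f :: "(real ^ 'n) set \<Rightarrow> (real ^ 'n) set \<Rightarrow> (real ^ 'n) set"
  assumes f: "body_operation f" "hausdorff_continuous f" "GL_covariant f"
    and KL: "K \<in> convex_bodies" "L \<in> convex_bodies"
  shows "(\<lambda>x. (u \<bullet> x) *\<^sub>R axis i 1) ` f K L
    = f ((\<lambda>x. (u \<bullet> x) *\<^sub>R axis i 1) ` K) ((\<lambda>x. (u \<bullet> x) *\<^sub>R axis i 1) ` L)"
proof -
  define g :: "real ^ 'n \<Rightarrow> real ^ 'n" where "g x = (u \<bullet> x) *\<^sub>R axis i 1" for x
  define s :: real where "s = (if u $ i < 0 then -1 else 1)"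
  define e :: "nat \<Rightarrow> real" where "e m = s * inverse (real (Suc m))" for m
  define h where "h m x = g x + e m *\<^sub>R x" for m x
  have e: "e \<longlonglongrightarrow> 0"
    unfolding e_def using tendsto_mult_left[OF LIMSEQ_inverse_real_of_nat, of s] by simp
  have e_ne: "e m \<noteq> 0" for m
    by (simp add: e_def s_def)
  \<comment> \<open>the only nontrivial eigenvalue of \<open>g\<close> is \<open>u $ i\<close>, and \<open>e m\<close> has been given its sign\<close>
  have eu_ne: "u $ i + e m \<noteq> 0" for m
  proof -
    have "u $ i < 0 \<Longrightarrow> e m < 0" "\<not> u $ i < 0 \<Longrightarrow> e m > 0"
      by (simp_all add: e_def s_def)
    then show ?thesis
      by linarith
  qed
  have lin_g: "linear g"
    unfolding g_def by (intro linearI) (auto simp: inner_right_distrib scaleR_add_left)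
  have lin_h: "linear (h m)" for m
    unfolding h_def using lin_g by (intro linear_compose_add) auto
  have h_matrix: "(\<lambda>x. matrix (h m) *v x) = h m" for m
    using matrix_vector_mul(2)[OF lin_h] by simp
  have inv: "invertible (matrix (h m))" for m
  proof -
    \<comment> \<open>A kernel vector of \<open>h m\<close> is a multiple of
      \<open>axis i 1\<close>, and there \<open>h m\<close> acts as multiplication by
      \<open>u $ i + e m\<close>.\<close>
    have "x = 0" if "h m x = 0" for x
    proof -
      define t where "t = - (u \<bullet> x) / e m"
      have "e m *\<^sub>R x = (- (u \<bullet> x)) *\<^sub>R axis i 1"
        using that by (simp add: h_def g_def eq_neg_iff_add_eq_0 add.commute)
      then have "inverse (e m) *\<^sub>R e m *\<^sub>R x = t *\<^sub>R axis i 1"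
        by (simp add: t_def divide_inverse_commute)
      then have "x = t *\<^sub>R axis i 1"
        using e_ne[of m] by simp
      moreover from this have "u \<bullet> x = t * u $ i"
        by (simp add: inner_axis)
      then have "t * (u $ i + e m) = 0"
        using e_ne[of m] by (simp add: t_def field_simps)
      ultimately show "x = 0"
        using eu_ne[of m] by simp
    qed
    then show ?thesis
      unfolding invertible_left_inverse matrix_left_invertible_ker
      using h_matrix[of m] by metis
  qed
  have cov: "h m ` f K L = f (h m ` K) (h m ` L)" for m
    using f(3) inv[of m] KL h_matrix[of m] unfolding GL_covariant_def by metis
  have M: "f K L \<in> convex_bodies"
    using f(1) KL by (simp add: body_operation_def)
  have bodies: "h m ` K \<in> convex_bodies" "h m ` L \<in> convex_bodies" "h m ` f K L \<in> convex_bodies"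
    "g ` K \<in> convex_bodies" "g ` L \<in> convex_bodies" "g ` f K L \<in> convex_bodies" for m
    using KL M lin_g lin_h convex_bodies_linear_image by blast+
  have lim: "hausdorff_tendsto (\<lambda>m. h m ` X) (g ` X)" if "X \<in> convex_bodies" for X
    unfolding h_def using hausdorff_tendsto_perturbed_image[OF that lin_g e] .
  have "hausdorff_tendsto (\<lambda>m. f (h m ` K) (h m ` L)) (f (g ` K) (g ` L))"
    by (rule f(2)[unfolded hausdorff_continuous_def, rule_format]) (simp_all add: bodies KL lim)
  then have "hausdorff_tendsto (\<lambda>m. h m ` f K L) (f (g ` K) (g ` L))"
    by (simp add: cov)
  moreover have "f (g ` K) (g ` L) \<in> convex_bodies"
    using f(1) bodies by (simp add: body_operation_def)
  ultimately have "g ` f K L = f (g ` K) (g ` L)"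
    using hausdorff_tendsto_unique[of "\<lambda>m. h m ` f K L", OF bodies(3,6) _ lim[OF M]] by simp
  then show ?thesis
    by (simp add: g_def)
qed

text \<open>This is \<open>f\<close> restricted to the \<open>i\<close>-th coordinate axis, the axis
  being identified with the reals; it is the \<open>G\<close> of the outline.\<close>

definition interval_operation ::
    "'n \<Rightarrow> ((real ^ 'n) set \<Rightarrow> (real ^ 'n) set \<Rightarrow> (real ^ 'n) set) \<Rightarrow> real set \<Rightarrow> real set \<Rightarrow> real set"
  where "interval_operation i f I J =
    (\<lambda>x. x $ i) ` f ((\<lambda>t. t *\<^sub>R axis i 1) ` I) ((\<lambda>t. t *\<^sub>R axis i 1) ` J)"

lemma inner_image_eq_interval_operation:
  fixes f :: "(real ^ 'n) set \<Rightarrow> (real ^ 'n) set \<Rightarrow> (real ^ 'n) set"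
  assumes "body_operation f" "hausdorff_continuous f" "GL_covariant f"
    and "K \<in> convex_bodies" "L \<in> convex_bodies"
  shows "(\<bullet>) u ` f K L = interval_operation i f ((\<bullet>) u ` K) ((\<bullet>) u ` L)"
proof -
  have "(\<bullet>) u ` f K L = (\<lambda>x. x $ i) ` (\<lambda>x. (u \<bullet> x) *\<^sub>R axis i 1) ` f K L"
    by (simp add: image_image)
  also have "\<dots> = interval_operation i f ((\<bullet>) u ` K) ((\<bullet>) u ` L)"
    by (simp add: rank_one_covariant[OF assms] interval_operation_def image_image)
  finally show ?thesis .
qed

text \<open>Place \<open>A\<close> and \<open>B\<close> in a coordinate plane, which exists as the
  dimension is at least 2. The value \<open>t\<close> is attained by the sum of two coordinate
  functionals at some point of the resulting body; \<open>r\<close> and \<open>s\<close> are the two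
  coordinates of that point.\<close>

lemma interval_operation_planar:
  fixes f :: "(real ^ 'n) set \<Rightarrow> (real ^ 'n) set \<Rightarrow> (real ^ 'n) set"
    and A B :: "(real \<times> real) set"
  assumes f: "body_operation f" "hausdorff_continuous f" "GL_covariant f"
    and card: "CARD('n) \<ge> 2"
    and A: "A \<noteq> {}" "compact A" "convex A" and B: "B \<noteq> {}" "compact B" "convex B"
    and t: "t \<in> interval_operation i f ((\<lambda>p. fst p + snd p) ` A) ((\<lambda>p. fst p + snd p) ` B)"
  obtains r s where "r \<in> interval_operation i f (fst ` A) (fst ` B)"
    "s \<in> interval_operation i f (snd ` A) (snd ` B)" "t = r + s"
proof -
  have "\<exists>j. j \<noteq> i"
  proof (rule ccontr)
    assume "\<nexists>j. j \<noteq> i"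
    then have "(UNIV :: 'n set) = {i}"
      by auto
    then have "CARD('n) = 1"
      by (metis is_singletonI is_singleton_altdef)
    with card show False
      by simp
  qed
  then obtain j where ij: "j \<noteq> i"
    by blast
  define emb :: "real \<times> real \<Rightarrow> real ^ 'n" where
    "emb p = fst p *\<^sub>R axis i 1 + snd p *\<^sub>R axis j 1" for p
  have lin: "linear emb"
    unfolding emb_def by (intro linearI) (auto simp: algebra_simps)
  have body: "emb ` X \<in> convex_bodies" if "X \<noteq> {}" "compact X" "convex X" for X
    using that lin
    by (auto simp: convex_bodies_def convex_linear_image
        intro!: compact_continuous_image linear_continuous_on linear_conv_bounded_linear[THEN iffD1])
  have img: "(\<bullet>) (axis i 1) ` emb ` X = fst ` X" "(\<bullet>) (axis j 1) ` emb ` X = snd ` X"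
    "(\<bullet>) (axis i 1 + axis j 1) ` emb ` X = (\<lambda>p. fst p + snd p) ` X" for X
    using ij by (auto simp: image_image emb_def inner_add_left inner_add_right inner_axis_axis)
  \<comment> \<open>The index stays \<open>i\<close> even for the functional
    \<open>axis j 1\<close>, so one operation governs all three projections.\<close>
  note G = inner_image_eq_interval_operation[OF f body[OF A] body[OF B], of _ i]
  from t obtain x where x: "x \<in> f (emb ` A) (emb ` B)" "t = (axis i 1 + axis j 1) \<bullet> x"
    using G[of "axis i 1 + axis j 1"] unfolding img by blast
  show thesis
  proof
    show "axis i 1 \<bullet> x \<in> interval_operation i f (fst ` A) (fst ` B)"
      using G[of "axis i 1"] x(1) unfolding img by blast
    show "axis j 1 \<bullet> x \<in> interval_operation i f (snd ` A) (snd ` B)"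
      using G[of "axis j 1"] x(1) unfolding img by blast
    show "t = axis i 1 \<bullet> x + axis j 1 \<bullet> x"
      by (simp add: x(2) inner_add_left)
  qed
qed

section \<open>Endpoints of the interval operation\<close>

lemma convex_bodies_axis_image:
  fixes i :: "'n :: finite"
  assumes "a \<le> b"
  shows "(\<lambda>t. t *\<^sub>R axis i 1) ` {a..b::real} \<in> (convex_bodies :: (real ^ 'n) set set)"
  using assms unfolding convex_bodies_def
  by (auto intro!: compact_continuous_image continuous_intros convex_linear_image linearI
      simp: scaleR_add_left)

lemma interval_operation_zero:
  fixes f :: "(real ^ 'n) set \<Rightarrow> (real ^ 'n) set \<Rightarrow> (real ^ 'n) set"
  assumes "identity_property f" "a \<le> b"
  shows "interval_operation i f {a..b} {0} = {a..b}" "interval_operation i f {0} {a..b} = {a..b}"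
  using assms convex_bodies_axis_image[OF assms(2), of i]
  by (simp_all add: interval_operation_def identity_property_def image_image)

text \<open>For crossed segments each coordinate sees one interval and one \<open>{0}\<close>, so
  the identity property determines both coordinate projections.\<close>

lemma interval_operation_bounds:
  fixes f :: "(real ^ 'n) set \<Rightarrow> (real ^ 'n) set \<Rightarrow> (real ^ 'n) set"
  assumes f: "body_operation f" "hausdorff_continuous f" "GL_covariant f" "identity_property f"
    and card: "CARD('n) \<ge> 2" and ab: "a \<le> b" and cd: "c \<le> d"
  shows "interval_operation i f {a..b} {c..d} \<subseteq> {a + c..b + d}"
proof
  fix t assume t: "t \<in> interval_operation i f {a..b} {c..d}"
  have img: "(\<lambda>p. fst p + snd p) ` ({a..b} \<times> {0}) = {a..b}"
    "(\<lambda>p. fst p + snd p) ` ({0} \<times> {c..d}) = {c..d}"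
    by force+
  have t': "t \<in> interval_operation i f ((\<lambda>p. fst p + snd p) ` ({a..b} \<times> {0}))
      ((\<lambda>p. fst p + snd p) ` ({0} \<times> {c..d}))"
    using t by (simp add: img)
  obtain r s where "r \<in> interval_operation i f {a..b} {0}"
      "s \<in> interval_operation i f {0} {c..d}" "t = r + s"
    using interval_operation_planar[OF f(1-3) card _ _ _ _ _ _ t'] ab cd
    by (auto simp: compact_Times convex_Times)
  then show "t \<in> {a + c..b + d}"
    using interval_operation_zero[OF f(4)] ab cd by auto
qed

text \<open>The triangle has vertices \<open>(a, 0)\<close>, \<open>(b, 0)\<close> and
  \<open>(b, a - b)\<close>. What matters is that \<open>fst\<close> and the sum have the same range
  while \<open>snd\<close> has range \<open>{a - b..0}\<close>.\<close>

lemma triangle_projections: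
  fixes a b :: real
  assumes "a \<le> b"
  defines "A \<equiv> {p. fst p \<le> b \<and> snd p \<le> 0 \<and> a \<le> fst p + snd p}"
  shows "A \<noteq> {}" "compact A" "convex A"
    "fst ` A = {a..b}" "snd ` A = {a - b..0}" "(\<lambda>p. fst p + snd p) ` A = {a..b}"
proof -
  have "(b, 0) \<in> A"
    using assms by simp
  then show "A \<noteq> {}"
    by blast
  have "closed A"
    unfolding A_def by (intro closed_Collect_conj closed_Collect_le continuous_intros)
  moreover have "A \<subseteq> {a..b} \<times> {a - b..0}"
    by (auto simp: A_def)
  ultimately show "compact A"
    using compact_Times[OF compact_Icc compact_Icc] by (metis compact_Int_closed inf.absorb2)
  have "A = (fst -` {..b}) \<inter> (snd -` {..0}) \<inter> ((\<lambda>p. fst p + snd p) -` {a..})"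
    by (auto simp: A_def)
  moreover have "linear (\<lambda>p :: real \<times> real. fst p + snd p)"
    by (intro linear_compose_add) (auto simp: linear_fst linear_snd)
  ultimately show "convex A"
    by (simp add: convex_Int convex_linear_vimage linear_fst linear_snd)
  show "fst ` A = {a..b}"
  proof (intro equalityI subsetI)
    fix x assume "x \<in> {a..b}"
    then show "x \<in> fst ` A"
      by (intro image_eqI[of _ _ "(x, 0)"]) (auto simp: A_def)
  qed (auto simp: A_def)
  show "snd ` A = {a - b..0}"
  proof (intro equalityI subsetI)
    fix x assume "x \<in> {a - b..0}"
    then show "x \<in> snd ` A"
      by (intro image_eqI[of _ _ "(b, x)"]) (auto simp: A_def)
  qed (auto simp: A_def)
  show "(\<lambda>p. fst p + snd p) ` A = {a..b}"
  proof (intro equalityI subsetI)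
    fix x assume "x \<in> {a..b}"
    then show "x \<in> (\<lambda>p. fst p + snd p) ` A"
      by (intro image_eqI[of _ _ "(x, 0)"]) (auto simp: A_def)
  qed (auto simp: A_def)
qed

lemma interval_operation_compact_nonempty:
  fixes f :: "(real ^ 'n) set \<Rightarrow> (real ^ 'n) set \<Rightarrow> (real ^ 'n) set"
  assumes "body_operation f" "a \<le> b" "c \<le> d"
  shows "compact (interval_operation i f {a..b} {c..d})" "interval_operation i f {a..b} {c..d} \<noteq> {}"
proof -
  have "f ((\<lambda>t. t *\<^sub>R axis i 1) ` {a..b}) ((\<lambda>t. t *\<^sub>R axis i 1) ` {c..d}) \<in> convex_bodies"
    using assms convex_bodies_axis_image unfolding body_operation_def by blast
  then show "compact (interval_operation i f {a..b} {c..d})"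
      "interval_operation i f {a..b} {c..d} \<noteq> {}"
    unfolding interval_operation_def
    by (auto dest: convex_bodiesD intro!: compact_continuous_image continuous_intros)
qed

lemma zero_in_interval_operation:
  fixes f :: "(real ^ 'n) set \<Rightarrow> (real ^ 'n) set \<Rightarrow> (real ^ 'n) set"
  assumes f: "body_operation f" "hausdorff_continuous f" "GL_covariant f" "identity_property f"
    and card: "CARD('n) \<ge> 2" and ab: "a \<le> b" and cd: "c \<le> d"
  shows "0 \<in> interval_operation i f {a - b..0} {c - d..0}"
proof -
  obtain m where m: "m \<in> interval_operation i f {a..b} {c..d}"
      "\<And>t. t \<in> interval_operation i f {a..b} {c..d} \<Longrightarrow> t \<le> m"
    using compact_attains_sup interval_operation_compact_nonempty[OF f(1) ab cd] by metis
  note A = triangle_projections[OF ab] and B = triangle_projections[OF cd]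
  \<comment> \<open>The maximum \<open>m\<close> is read as a value of the sum functional on the
    triangles. Its first part \<open>r\<close> lies in the same set, so \<open>r \<le> m\<close> and
    \<open>s\<close> cannot be negative.\<close>
  obtain r s where rs: "r \<in> interval_operation i f {a..b} {c..d}"
      "s \<in> interval_operation i f {a - b..0} {c - d..0}" "m = r + s"
    using interval_operation_planar[OF f(1-3) card A(1-3) B(1-3), of m i] m(1)
    unfolding A B by blast
  have "s \<le> 0"
    using interval_operation_bounds[OF f card, of "a - b" 0 "c - d" 0 i] rs(2) ab cd by auto
  moreover have "s \<ge> 0"
    using m(2)[OF rs(1)] rs(3) by simp
  ultimately show ?thesis
    using rs(2) by simp
qed

text \<open>The segments at heights \<open>- b\<close> and \<open>- d\<close> have sums ending at 0,
  which turns the previous lemma into a statement about \<open>{a..b}\<close> and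
  \<open>{c..d}\<close>.\<close>

lemma add_in_interval_operation:
  fixes f :: "(real ^ 'n) set \<Rightarrow> (real ^ 'n) set \<Rightarrow> (real ^ 'n) set"
  assumes f: "body_operation f" "hausdorff_continuous f" "GL_covariant f" "identity_property f"
    and card: "CARD('n) \<ge> 2" and ab: "a \<le> b" and cd: "c \<le> d"
  shows "b + d \<in> interval_operation i f {a..b} {c..d}"
proof -
  have img: "(\<lambda>p. fst p + snd p) ` ({x..y} \<times> {- y}) = {x - y..0}" for x y :: real
  proof -
    have "{x..y} \<times> {- y} = (\<lambda>t. (t, - y)) ` {x..y}"
      by auto
    then have "(\<lambda>p. fst p + snd p) ` ({x..y} \<times> {- y}) = (\<lambda>t. t - y) ` {x..y}"
      by (simp only: image_image fst_conv snd_conv add_uminus_conv_diff)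
    also have "\<dots> = {x - y..0}"
      by (simp add: image_diff_atLeastAtMost)
    finally show ?thesis .
  qed
  have 0: "0 \<in> interval_operation i f ((\<lambda>p. fst p + snd p) ` ({a..b} \<times> {- b}))
      ((\<lambda>p. fst p + snd p) ` ({c..d} \<times> {- d}))"
    unfolding img by (rule zero_in_interval_operation[OF assms])
  obtain r s where rs: "r \<in> interval_operation i f {a..b} {c..d}"
      "s \<in> interval_operation i f {- b} {- d}" "0 = r + s"
    using interval_operation_planar[OF f(1-3) card _ _ _ _ _ _ 0] ab cd
    by (auto simp: compact_Times convex_Times)
  \<comment> \<open>For one-point intervals the upper and lower bounds coincide.\<close>
  have "s = - b - d"
    using interval_operation_bounds[OF f card, of "- b" "- b" "- d" "- d" i] rs(2) by auto
  then have "r = b + d"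
    using rs(3) by simp
  with rs(1) show ?thesis
    by simp
qed

subsection \<open>Comparison of support functions\<close>

lemma inner_image_convex_body:
  fixes K :: "(real ^ 'n) set"
  assumes "K \<in> convex_bodies"
  obtains a b where "a \<le> b" "(\<bullet>) u ` K = {a..b}"
proof -
  have "connected ((\<bullet>) u ` K)" "compact ((\<bullet>) u ` K)"
    using convex_bodiesD[OF assms]
    by (auto intro!: connected_continuous_image compact_continuous_image continuous_intros
        dest: convex_connected)
  then obtain a b where "(\<bullet>) u ` K = {a..b}"
    by (metis connected_compact_interval_1)
  moreover have "(\<bullet>) u ` K \<noteq> {}"
    using assms by (auto dest: convex_bodiesD)
  ultimately show ?thesis
    using that[of a b] by (cases "a \<le> b") auto
qed

text \<open>A point outside the closed convex set \<open>M\<close> is strictly separated from it, so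
  comparing support functions decides inclusion.\<close>

lemma convex_bodies_subsetI:
  assumes "K \<in> convex_bodies" "M \<in> convex_bodies"
    and "\<And>u x. x \<in> K \<Longrightarrow> \<exists>y\<in>M. u \<bullet> x \<le> u \<bullet> y"
  shows "K \<subseteq> M"
proof
  fix x assume x: "x \<in> K"
  show "x \<in> M"
  proof (rule ccontr)
    assume "x \<notin> M"
    moreover have "convex M" "closed M"
      using assms(2) by (auto dest: convex_bodiesD compact_imp_closed)
    ultimately obtain u \<beta> where "u \<bullet> x < \<beta>" "\<And>y. y \<in> M \<Longrightarrow> u \<bullet> y > \<beta>"
      using separating_hyperplane_closed_point by metis
    \<comment> \<open>The separation puts \<open>x\<close> on the lower side of \<open>M\<close>,
      hence the sign change.\<close>
    with assms(3)[OF x, of "- u"] show False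
      by force
  qed
qed

lemma eq_Minkowski_sum:
  fixes f :: "(real ^ 'n) set \<Rightarrow> (real ^ 'n) set \<Rightarrow> (real ^ 'n) set"
  assumes f: "body_operation f" "hausdorff_continuous f" "GL_covariant f" "identity_property f"
    and card: "CARD('n) \<ge> 2" and KL: "K \<in> convex_bodies" "L \<in> convex_bodies"
  shows "f K L = K + L"
proof
  have M: "f K L \<in> convex_bodies"
    using f(1) KL by (simp add: body_operation_def)
  \<comment> \<open>The axis may be chosen freely; \<open>undefined\<close> merely fixes one index
    for all \<open>u\<close>.\<close>
  note G = inner_image_eq_interval_operation[OF f(1-3) KL, of _ undefined]
  show "f K L \<subseteq> K + L"
  proof (rule convex_bodies_subsetI[OF M convex_bodies_plus[OF KL]])
    fix u x assume x: "x \<in> f K L"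
    obtain a b where ab: "a \<le> b" "(\<bullet>) u ` K = {a..b}"
      using inner_image_convex_body[OF KL(1)] .
    obtain c d where cd: "c \<le> d" "(\<bullet>) u ` L = {c..d}"
      using inner_image_convex_body[OF KL(2)] .
    \<comment> \<open>The right ends \<open>b\<close> and \<open>d\<close> are the support functions
      at \<open>u\<close>; the points \<open>k\<close> and \<open>l\<close> attaining them give the
      witness \<open>k + l\<close>.\<close>
    have "b \<in> (\<bullet>) u ` K" "d \<in> (\<bullet>) u ` L"
      using ab cd by auto
    then obtain k l where kl: "k \<in> K" "u \<bullet> k = b" "l \<in> L" "u \<bullet> l = d"
      by blast
    have "u \<bullet> x \<in> interval_operation undefined f {a..b} {c..d}"
      using G[of u] x unfolding ab cd by blast
    with interval_operation_bounds[OF f card ab(1) cd(1)] have "u \<bullet> x \<le> b + d"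
      by (meson atLeastAtMost_iff subsetD)
    with kl show "\<exists>y\<in>K + L. u \<bullet> x \<le> u \<bullet> y"
      by (intro bexI[of _ "k + l"]) (auto simp: inner_add_right)
  qed
  show "K + L \<subseteq> f K L"
  proof (rule convex_bodies_subsetI[OF convex_bodies_plus[OF KL] M])
    fix u x assume "x \<in> K + L"
    then obtain k l where kl: "x = k + l" "k \<in> K" "l \<in> L"
      by (auto elim: set_plus_elim)
    obtain a b where ab: "a \<le> b" "(\<bullet>) u ` K = {a..b}"
      using inner_image_convex_body[OF KL(1)] .
    obtain c d where cd: "c \<le> d" "(\<bullet>) u ` L = {c..d}"
      using inner_image_convex_body[OF KL(2)] .
    have "b + d \<in> (\<bullet>) u ` f K L"
      unfolding G ab cd by (rule add_in_interval_operation[OF f card ab(1) cd(1)])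
    then obtain y where y: "y \<in> f K L" "u \<bullet> y = b + d"
      by force
    have "u \<bullet> k \<le> b" "u \<bullet> l \<le> d"
      using ab cd kl by (metis imageI atLeastAtMost_iff)+
    with y show "\<exists>y\<in>f K L. u \<bullet> x \<le> u \<bullet> y"
      by (intro bexI[of _ y]) (auto simp: kl(1) inner_add_right)
  qed
qed

(* K + L is the elementwise (Minkowski) sum of sets. *)
theorem theoremB:
  fixes f :: "(real ^ 'n) set \<Rightarrow> (real ^ 'n) set \<Rightarrow> (real ^ 'n) set"
  assumes "CARD('n) \<ge> 2"
    and "body_operation f"
  shows "hausdorff_continuous f \<and> GL_covariant f \<and> identity_property f \<longleftrightarrow>
    (\<forall>K\<in>convex_bodies. \<forall>L\<in>convex_bodies. f K L = K + L)"
  using assms eq_Minkowski_sum hausdorff_continuous_Minkowski[of f] GL_covariant_Minkowski[of f]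
    identity_property_Minkowski[of f]
  by blast

end
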